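(* Let $\delta\in(0,1]$ and $0<\lambda<\frac{1}{(\sqrt{2\delta}+\sqrt{1-\delta})^2}$ be constants. Let $G\sim\mathcal{G}(n,\lambda,\delta)$ be generated from the planted cycles model, conditional on the planted $2$-factor $H^*$. There exists a constant $C$ independent of $n$ such that $\mathbb{E}[|H^*\Delta H|]\le C$ for any $2$-factor $H$ on $\delta n$ vertices contained in $G$ (where $H$ may be chosen depending on $G$).
   Context: Planted cycles model $\mathcal{G}(n,\lambda,\delta)$: generate an Erdős–Rényi graph $G_0\sim\mathcal{G}(n,\lambda/n)$ on vertex set $[n]$; independently choose a uniformly random set $V\subseteq[n]$ of $\lfloor\delta n\rfloor$ vertices (written $\delta n$); then choose a uniformly random labeled $2$-factor $H^*$ on $V$, i.e. a vertex-disjoint union of cycles spanning all vertices of $V$. Output the simple graph $G=G_0\cup H^*$. "Conditional on $H^*$" means that $H^*$ is fixed and the only randomness comes from $G_0$. A $2$-factor on $\delta n$ vertices in $G$ is a subgraph of $G$ that is a vertex-disjoint union of cycles with exactly $\lfloor\delta n\rfloor$ vertices in total (its vertex set may differ from $V$). Graphs are identified with their edge sets; $\Delta$ is the symmetric difference and $|\cdot|$ the number of edges. *)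

theory Defs
  imports "HOL-Probability.Probability"
begin

text \<open>Graphs are identified with their edge sets; an edge is a two-element set of vertices.\<close>

type_synonym 'a graph = "'a set set"

definition cycle_edges :: "'a list \<Rightarrow> 'a graph" where
  "cycle_edges vs = {{vs ! i, vs ! (Suc i mod length vs)} | i. i < length vs}"

definition is_cycle :: "'a graph \<Rightarrow> bool" where
  "is_cycle C \<longleftrightarrow> (\<exists>vs. 3 \<le> length vs \<and> distinct vs \<and> C = cycle_edges vs)"

text \<open>A 2-factor has no isolated vertices, so its vertex set is the union of its edges.\<close>

definition two_factor_on :: "'a set \<Rightarrow> 'a graph \<Rightarrow> bool" where
  "two_factor_on V F \<longleftrightarrow>
     (\<exists>\<C>. (\<forall>C\<in>\<C>. is_cycle C) \<and>
          pairwise (\<lambda>C D. \<Union>C \<inter> \<Union>D = {}) \<C> \<and>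
          F = \<Union>\<C> \<and> \<Union>F = V)"

definition complete_edges :: "nat \<Rightarrow> nat graph" where
  "complete_edges n = {e. e \<subseteq> {1..n} \<and> card e = 2}"

definition erdos_renyi :: "nat \<Rightarrow> real \<Rightarrow> nat graph pmf" where
  "erdos_renyi n p =
     map_pmf (\<lambda>X. {e \<in> complete_edges n. X e})
       (Pi_pmf (complete_edges n) False (\<lambda>_. bernoulli_pmf p))"

definition planted_size :: "real \<Rightarrow> nat \<Rightarrow> nat" where
  "planted_size \<delta> n = nat \<lfloor>\<delta> * real n\<rfloor>"

definition two_factors_in :: "'a graph \<Rightarrow> nat \<Rightarrow> 'a graph set" where
  "two_factors_in G m = {F. F \<subseteq> G \<and> (\<exists>V. card V = m \<and> two_factor_on V F)}"

text \<open>
  The law of \<open>G = G\<^sub>0 \<union> Hstar\<close> in the planted cycles model, conditional on the planted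
  2-factor \<open>Hstar\<close>: since \<open>Hstar\<close> is independent of \<open>G\<^sub>0\<close>, only \<open>G\<^sub>0\<close> is random. The parameter
  \<open>\<delta>\<close> enters only through the vertex count of \<open>Hstar\<close>, which ranges over
  \<open>two_factors_in (complete_edges n) (planted_size \<delta> n)\<close>.
\<close>

definition planted_cycles_given :: "nat \<Rightarrow> real \<Rightarrow> nat graph \<Rightarrow> nat graph pmf" where
  "planted_cycles_given n lam Hstar =
     map_pmf (\<lambda>G\<^sub>0. G\<^sub>0 \<union> Hstar) (erdos_renyi n (lam / real n))"

end

theory Submission
  imports Defs "HOL-Combinatorics.Cycles"
begin

text \<open>
  Write \<open>S = H - Hstar\<close>. Both 2-factors have equally many edges, so \<open>|Hstar \<Delta> H| = 2|S|\<close>, and it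
  suffices to bound \<open>\<Sum>\<^sub>S |S| p^|S|\<close> over all possible \<open>S\<close>, where \<open>p = \<lambda>/n\<close>. Summing over \<open>S\<close> rather
  than over \<open>H\<close> is essential: whole cycles of \<open>Hstar\<close> that \<open>H\<close> omits are not recorded in \<open>S\<close>, and
  the number of ways to choose them is unbounded in \<open>n\<close>.

  Following the edges of \<open>S\<close> and of \<open>Hstar - H\<close> alternately decomposes \<open>S\<close> into circuits. On entering
  a vertex \<open>v\<close> of \<open>V\<close>, a circuit walks along \<open>Hstar - H\<close> in one of two directions for \<open>r \<ge> 1\<close> steps, the
  \<open>r - 1\<close> interior vertices being removed by \<open>H\<close>; on entering a vertex outside \<open>V\<close> it leaves at once
  through \<open>S\<close>. Such a visit is a letter, of weight \<open>p x^(r - 1)\<close> or \<open>p / x\<close> with a parameter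
  \<open>0 < x < 1\<close>. As \<open>H\<close> adds as many vertices as it removes, \<open>p^|S|\<close> is at most the product of the
  weights. The circuits form a permutation of the set of letters used, hence are recorded by a word
  in these letters, so the sum is at most \<open>\<Sum>\<^sub>k k \<rho>^k\<close>, where
  \<open>\<rho> \<approx> 2\<delta>\<lambda>/(1 - x) + (1 - \<delta>)\<lambda>/x\<close> is the total weight of all letters. The minimum over \<open>x\<close> is
  \<open>\<lambda>(\<surd>(2\<delta>) + \<surd>(1 - \<delta>))\<^sup>2\<close>, attained at \<open>x = \<surd>(1 - \<delta>) / (\<surd>(2\<delta>) + \<surd>(1 - \<delta>))\<close>
  (for \<open>\<delta> = 1\<close> only an infimum, as \<open>x\<close> tends to 0).
\<close>

section \<open>Two-colouring for a pair of fixed-point-free involutions\<close>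

text \<open>The union of two perfect matchings is bipartite; the induction contracts the pair \<open>{a, g a}\<close>.\<close>

lemma involutions_two_colouring:
  assumes "finite P"
    and "\<And>q. q \<in> P \<Longrightarrow> f q \<in> P \<and> f (f q) = q \<and> f q \<noteq> q"
    and "\<And>q. q \<in> P \<Longrightarrow> g q \<in> P \<and> g (g q) = q \<and> g q \<noteq> q"
  shows "\<exists>c :: 'a \<Rightarrow> bool. \<forall>q\<in>P. c (f q) \<noteq> c q \<and> c (g q) \<noteq> c q"
  using assms
proof (induction "card P" arbitrary: P f rule: less_induct)
  case less
  show ?case
  proof (cases "P = {}")
    case False
    then obtain a where a: "a \<in> P" by blast
    define b where "b = g a"
    have b: "b \<in> P" "a \<noteq> b" "g b = a" using less.prems(3)[OF a] by (auto simp: b_def)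
    define P' where "P' = P - {a, b}"
    \<comment> \<open>Removing \<open>a\<close> and \<open>b\<close> leaves their
      \<open>f\<close>-partners unmatched, so \<open>f'\<close> matches these two with each
      other.\<close>
    define f' where "f' = (\<lambda>q. if f q = a then f b else if f q = b then f a else f q)"
    note F = less.prems(2) and G = less.prems(3)
    have fin: "finite P'" and sub: "P' \<subseteq> P" using less.prems(1) by (auto simp: P'_def)
    have card: "card P' < card P"
      using a less.prems(1) by (intro psubset_card_mono) (auto simp: P'_def)
    have f': "f' q \<in> P' \<and> f' (f' q) = q \<and> f' q \<noteq> q" if "q \<in> P'" for q
    proof -
      have q: "q \<in> P" "q \<noteq> a" "q \<noteq> b" using that by (auto simp: P'_def)
      consider "f q = a" | "f q = b" | "f q \<noteq> a" "f q \<noteq> b" by blast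
      then show ?thesis
      proof cases
        case 1
        then have "f a = q" "f b \<noteq> a" "f b \<noteq> b" "f b \<in> P" "f (f b) = b" "f b \<noteq> q" using F[OF q(1)] F[OF b(1)] b q by auto
        then show ?thesis using 1 b(2) q by (auto simp: f'_def P'_def)
      next
        case 2
        then have "f b = q" "f a \<noteq> a" "f a \<noteq> b" "f a \<in> P" "f (f a) = a" "f a \<noteq> q" using F[OF q(1)] F[OF a] b q by auto
        then show ?thesis using 2 b(2) q by (auto simp: f'_def P'_def)
      next
        case 3
        then show ?thesis using F[OF q(1)] q by (auto simp: f'_def P'_def)
      qed
    qed
    have g': "g q \<in> P' \<and> g (g q) = q \<and> g q \<noteq> q" if "q \<in> P'" for q
    proof -
      have q: "q \<in> P" "q \<noteq> a" "q \<noteq> b" using that by (auto simp: P'_def)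
      then have "g q \<noteq> a" "g q \<noteq> b" using G[OF q(1)] b b_def by auto
      then show ?thesis using G[OF q(1)] by (auto simp: P'_def)
    qed
    obtain c :: "'a \<Rightarrow> bool" where c: "\<And>q. q \<in> P' \<Longrightarrow> c (f' q) \<noteq> c q \<and> c (g q) \<noteq> c q"
      using less.hyps[OF card fin f' g'] by blast
    define c' where "c' = (if f a = b then c(a := True, b := False)
                           else c(a := \<not> c (f a), b := \<not> c (f b)))"
    have fa: "f a \<in> P" "f a \<noteq> a" "f (f a) = a" and fb: "f b \<in> P" "f b \<noteq> b" "f (f b) = b"
      using F[OF a] F[OF b(1)] by auto
    \<comment> \<open>If \<open>f a = b\<close>, the pair is a component of its own. Otherwise
      \<open>f'\<close> matches \<open>f a\<close> with \<open>f b\<close>, so their colours differ,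
      and so do the opposite colours given to \<open>a\<close> and \<open>b\<close>.\<close>
    have ne: "c' a \<noteq> c' b \<and> (f a \<noteq> b \<longrightarrow> c' a = (\<not> c (f a)) \<and> c' b = (\<not> c (f b)))"
    proof (cases "f a = b")
      case False
      have "f b \<noteq> a" using False fb by auto
      then have "f a \<in> P'" using fa False by (auto simp: P'_def)
      from c[OF this] have "c (f b) \<noteq> c (f a)" using fa by (auto simp: f'_def)
      then show ?thesis using False b(2) by (auto simp: c'_def)
    qed (use b(2) in \<open>auto simp: c'_def\<close>)
    have c'eq: "c' q = c q" if "q \<in> P'" for q using that by (auto simp: c'_def P'_def)
    have "c' (f q) \<noteq> c' q \<and> c' (g q) \<noteq> c' q" if q: "q \<in> P" for q
    proof -
      consider "q = a" | "q = b" | "q \<in> P'" using q by (auto simp: P'_def)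
      then show ?thesis
      proof cases
        case 1
        have "c' (f a) \<noteq> c' a"
        proof (cases "f a = b")
          case False
          then have "f a \<in> P'" using fa by (auto simp: P'_def)
          then show ?thesis using ne False c'eq by auto
        qed (use ne in auto)
        then show ?thesis using 1 ne b_def by auto
      next
        case 2
        have "c' (f b) \<noteq> c' b"
        proof (cases "f b = a")
          case False
          then have "f b \<in> P'" "f a \<noteq> b" using fb fa by (auto simp: P'_def)
          then show ?thesis using ne c'eq by auto
        qed (use ne in auto)
        then show ?thesis using 2 ne b by auto
      next
        case 3
        have g: "c' (g q) \<noteq> c' q" using c[OF 3] g'[OF 3] c'eq 3 by auto
        have q': "q \<noteq> a" "q \<noteq> b" using 3 by (auto simp: P'_def)
        have "c' (f q) \<noteq> c' q"
        proof (cases "f q \<in> P'")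
          case True
          then have "f' q = f q" by (auto simp: f'_def P'_def)
          then show ?thesis using c[OF 3] c'eq True 3 by auto
        next
          case False
          then have "f q = a \<or> f q = b" using F[OF q] by (auto simp: P'_def)
          then have "(f q = a \<and> f a = q) \<or> (f q = b \<and> f b = q)" using F[OF q] by auto
          moreover have "f a \<noteq> b" using calculation q' fa by auto
          ultimately show ?thesis using ne c'eq[OF 3] by auto
        qed
        then show ?thesis using g by auto
      qed
    qed
    then show ?thesis by blast
  qed auto
qed

section \<open>Cyclic orientations of 2-factors\<close>

text \<open>The orbits of \<open>\<sigma>\<close> on \<open>V\<close> are the cycles of
  \<open>F\<close>, each with a chosen direction. Orbits of length 2 are excluded, as their two arcs
  would give the same edge.\<close>

definition cyclic_orientation :: "('a \<Rightarrow> 'a) \<Rightarrow> 'a set \<Rightarrow> 'a graph \<Rightarrow> bool" where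
  "cyclic_orientation \<sigma> V F \<longleftrightarrow>
     \<sigma> permutes V \<and> (\<forall>v\<in>V. \<sigma> v \<noteq> v \<and> \<sigma> (\<sigma> v) \<noteq> v) \<and> F = (\<lambda>v. {v, \<sigma> v}) ` V"

lemma cycle_orientation:
  assumes "is_cycle C"
  shows "\<exists>\<sigma>. cyclic_orientation \<sigma> (\<Union>C) C"
proof -
  obtain vs where vs: "3 \<le> length vs" "distinct vs" "C = cycle_edges vs"
    using assms by (auto simp: is_cycle_def)
  define k where "k = length vs"
  define ix where "ix = the_inv_into {..<k} ((!) vs)"
  have inj: "inj_on ((!) vs) {..<k}" using vs by (auto simp: inj_on_def k_def nth_eq_iff_index_eq)
  have ix: "ix (vs ! i) = i" if "i < k" for i
    using inj that unfolding ix_def by (auto intro: the_inv_into_f_f)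
  have k: "k \<ge> 3" using vs k_def by simp
  have lt: "i mod k < k" for i using k by simp
  have nth_eq: "vs ! i = vs ! j \<longleftrightarrow> i = j" if "i < k" "j < k" for i j
    using that vs(2) by (simp add: k_def nth_eq_iff_index_eq)
  have C: "C = (\<lambda>i. {vs ! i, vs ! (Suc i mod k)}) ` {..<k}"
    unfolding vs(3) cycle_edges_def k_def by auto
  have UC: "\<Union>C = set vs"
  proof
    show "\<Union>C \<subseteq> set vs"
    proof -
      have "i < k \<Longrightarrow> vs ! i \<in> set vs \<and> vs ! (Suc i mod k) \<in> set vs" for i
        using k by (auto simp: k_def intro!: nth_mem mod_less_divisor)
      then show ?thesis unfolding C by auto
    qed
    show "set vs \<subseteq> \<Union>C" unfolding C by (auto simp: k_def in_set_conv_nth)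
  qed
  define \<sigma> where "\<sigma> v = (if v \<in> set vs then vs ! (Suc (ix v) mod k) else v)" for v
  have \<sigma>: "\<sigma> (vs ! i) = vs ! (Suc i mod k)" if "i < k" for i
    using that ix by (auto simp: \<sigma>_def k_def)
  have setvs: "set vs = (!) vs ` {..<k}" by (auto simp: set_conv_nth k_def)
  have inj\<sigma>: "inj_on \<sigma> (set vs)"
  proof (rule inj_onI)
    fix x y assume "x \<in> set vs" "y \<in> set vs" and e: "\<sigma> x = \<sigma> y"
    then obtain i j where ij: "i < k" "j < k" "x = vs ! i" "y = vs ! j" by (auto simp: setvs)
    have "Suc i mod k = Suc j mod k"
      using e ij \<sigma> nth_eq[OF lt lt] by simp
    then have "i = j" using ij by (auto simp: mod_Suc split: if_splits)
    then show "x = y" using ij by simp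
  qed
  have "\<sigma> ` set vs \<subseteq> set vs" using lt by (auto simp: \<sigma>_def k_def)
  then have "bij_betw \<sigma> (set vs) (set vs)"
    using inj\<sigma> by (simp add: bij_betw_def endo_inj_surj)
  then have perm: "\<sigma> permutes set vs"
    by (rule bij_imp_permutes) (auto simp: \<sigma>_def)
  have ne: "\<sigma> v \<noteq> v \<and> \<sigma> (\<sigma> v) \<noteq> v" if "v \<in> set vs" for v
  proof -
    obtain i where i: "i < k" "v = vs ! i" using \<open>v \<in> set vs\<close> by (auto simp: setvs)
    have "Suc i mod k \<noteq> i" "Suc (Suc i mod k) mod k \<noteq> i"
      using i k by (auto simp: mod_Suc)
    then show ?thesis using i \<sigma> lt nth_eq by simp
  qed
  have "C = (\<lambda>v. {v, \<sigma> v}) ` set vs" unfolding C setvs image_image using \<sigma> by auto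
  then show ?thesis using perm ne UC by (auto simp: cyclic_orientation_def)
qed

text \<open>Disjointness puts every vertex on exactly one cycle, so the orientations of the single
  cycles glue together.\<close>

lemma two_factor_orientation:
  assumes "two_factor_on V F"
  shows "\<exists>\<sigma>. cyclic_orientation \<sigma> V F"
proof -
  obtain \<C> where \<C>: "\<And>C. C \<in> \<C> \<Longrightarrow> is_cycle C"
      "\<And>C D. C \<in> \<C> \<Longrightarrow> D \<in> \<C> \<Longrightarrow> C \<noteq> D \<Longrightarrow> \<Union>C \<inter> \<Union>D = {}"
      "F = \<Union>\<C>" "\<Union>F = V"
    using assms unfolding two_factor_on_def pairwise_def by metis
  obtain s where s: "\<And>C. C \<in> \<C> \<Longrightarrow> cyclic_orientation (s C) (\<Union>C) C"
    using \<C>(1) cycle_orientation by metis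
  define cyc where "cyc v = (THE C. C \<in> \<C> \<and> v \<in> \<Union>C)" for v
  have cyc: "cyc v = C" if "C \<in> \<C>" "v \<in> \<Union>C" for v C
    unfolding cyc_def using that \<C>(2) by (intro the_equality) blast+
  define \<sigma> where "\<sigma> v = (if v \<in> V then s (cyc v) v else v)" for v
  have \<sigma>: "\<sigma> v = s C v" if "C \<in> \<C>" "v \<in> \<Union>C" for v C
    using that cyc \<C>(3,4) by (auto simp: \<sigma>_def)
  have bij: "bij_betw \<sigma> (\<Union>C) (\<Union>C)" if "C \<in> \<C>" for C
  proof -
    have "bij_betw (s C) (\<Union>C) (\<Union>C)"
      using s[OF that] by (auto simp: cyclic_orientation_def intro: permutes_imp_bij)
    then show ?thesis using bij_betw_cong[of "\<Union>C" \<sigma> "s C" "\<Union>C"] \<sigma>[OF that] by blast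
  qed
  have V: "V = (\<Union>C\<in>\<C>. \<Union>C)" using \<C>(3,4) by auto
  have "bij_betw \<sigma> V V"
    unfolding bij_betw_def
  proof
    show "\<sigma> ` V = V" unfolding V image_UN using bij by (auto simp: bij_betw_def)
    show "inj_on \<sigma> V"
    proof (rule inj_onI)
      fix x y assume xy: "x \<in> V" "y \<in> V" "\<sigma> x = \<sigma> y"
      obtain C D where CD: "C \<in> \<C>" "x \<in> \<Union>C" "D \<in> \<C>" "y \<in> \<Union>D" using xy V by blast
      have "\<sigma> x \<in> \<Union>C" "\<sigma> y \<in> \<Union>D" using bij CD by (meson bij_betw_apply)+
      then have "C = D" using \<C>(2)[OF CD(1,3)] xy(3) by auto
      then show "x = y" using bij[OF CD(1)] CD xy(3) by (auto simp: bij_betw_def inj_on_def)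
    qed
  qed
  then have "\<sigma> permutes V" by (rule bij_imp_permutes) (auto simp: \<sigma>_def)
  moreover have "\<sigma> v \<noteq> v \<and> \<sigma> (\<sigma> v) \<noteq> v" if "v \<in> V" for v
  proof -
    obtain C where C: "C \<in> \<C>" "v \<in> \<Union>C" using \<open>v \<in> V\<close> V by blast
    then have "\<sigma> v \<in> \<Union>C" using bij by (meson bij_betw_apply)
    then show ?thesis using s[OF C(1)] \<sigma>[OF C(1)] C(2) by (auto simp: cyclic_orientation_def)
  qed
  moreover have "F = (\<lambda>v. {v, \<sigma> v}) ` V"
  proof -
    have "C = (\<lambda>v. {v, \<sigma> v}) ` (\<Union>C)" if "C \<in> \<C>" for C
    proof -
      have "C = (\<lambda>v. {v, s C v}) ` (\<Union>C)" using s[OF that] by (simp add: cyclic_orientation_def)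
      also have "\<dots> = (\<lambda>v. {v, \<sigma> v}) ` (\<Union>C)" using \<sigma>[OF that] by (intro image_cong) auto
      finally show ?thesis .
    qed
    then have "(\<Union>C\<in>\<C>. C) = (\<Union>C\<in>\<C>. (\<lambda>v. {v, \<sigma> v}) ` (\<Union>C))" by (rule SUP_cong[OF refl])
    then show ?thesis unfolding V image_UN \<C>(3) by simp
  qed
  ultimately show ?thesis by (auto simp: cyclic_orientation_def)
qed

definition step :: "('a \<Rightarrow> 'a) \<Rightarrow> bool \<Rightarrow> 'a \<Rightarrow> 'a" where
  "step \<sigma> d = (if d then \<sigma> else inv \<sigma>)"

text \<open>Since no orbit has length 2, \<open>\<sigma> v\<close> and \<open>inv \<sigma> v\<close>
  differ, so the two directions index the two edges at \<open>v\<close>.\<close>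

lemma cyclic_orientation_step:
  assumes "cyclic_orientation \<sigma> V F"
  shows "step \<sigma> d permutes V"
    and "step \<sigma> (\<not> d) (step \<sigma> d v) = v"
    and "v \<in> V \<Longrightarrow> step \<sigma> d v \<noteq> v"
    and "v \<in> V \<Longrightarrow> inj (\<lambda>d. {v, step \<sigma> d v})"
    and "v \<in> V \<Longrightarrow> {e \<in> F. v \<in> e} = range (\<lambda>d. {v, step \<sigma> d v})"
proof -
  have p: "\<sigma> permutes V" and n: "\<And>v. v \<in> V \<Longrightarrow> \<sigma> v \<noteq> v \<and> \<sigma> (\<sigma> v) \<noteq> v"
    and F: "F = (\<lambda>v. {v, \<sigma> v}) ` V" using assms by (auto simp: cyclic_orientation_def)
  note inv = permutes_inverses[OF p]
  show "step \<sigma> d permutes V" using p permutes_inv[OF p] by (simp add: step_def)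
  show "step \<sigma> (\<not> d) (step \<sigma> d v) = v" using inv by (simp add: step_def)
  have iV: "v \<in> V \<Longrightarrow> inv \<sigma> v \<in> V" for v using permutes_in_image[OF permutes_inv[OF p]] by simp
  show ne: "step \<sigma> d v \<noteq> v" if "v \<in> V" using n[OF that] inv by (metis step_def)
  have ne2: "\<sigma> v \<noteq> inv \<sigma> v" if "v \<in> V" using n[OF that] inv by metis
  show "inj (\<lambda>d. {v, step \<sigma> d v})" if "v \<in> V"
    using ne2[OF that] n[OF that] by (auto simp: inj_def step_def doubleton_eq_iff split: if_splits)
  show "{e \<in> F. v \<in> e} = range (\<lambda>d. {v, step \<sigma> d v})" if "v \<in> V"
  proof -
    have "{e \<in> F. v \<in> e} = {{v, \<sigma> v}, {v, inv \<sigma> v}}"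
    proof
      show "{e \<in> F. v \<in> e} \<subseteq> {{v, \<sigma> v}, {v, inv \<sigma> v}}" unfolding F using inv by auto
      have "{v, inv \<sigma> v} = {inv \<sigma> v, \<sigma> (inv \<sigma> v)}" using inv by auto
      then show "{{v, \<sigma> v}, {v, inv \<sigma> v}} \<subseteq> {e \<in> F. v \<in> e}" unfolding F using that iV by auto
    qed
    also have "\<dots> = range (\<lambda>d. {v, step \<sigma> d v})" by (auto simp: step_def UNIV_bool)
    finally show ?thesis .
  qed
qed

lemma cyclic_orientation_card:
  assumes "cyclic_orientation \<sigma> V F"
  shows "card F = card V"
proof -
  have "inj_on (\<lambda>v. {v, \<sigma> v}) V"
  proof (rule inj_onI)
    fix x y assume "x \<in> V" "y \<in> V" "{x, \<sigma> x} = {y, \<sigma> y}"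
    then show "x = y" using assms by (auto simp: cyclic_orientation_def doubleton_eq_iff)
  qed
  then show ?thesis using assms by (auto simp: cyclic_orientation_def card_image)
qed

lemma cyclic_orientation_edge:
  assumes "cyclic_orientation \<sigma> V F" "e \<in> F"
  shows "card e = 2" "e \<subseteq> V"
  using assms permutes_in_image[of \<sigma> V]
  by (auto simp: cyclic_orientation_def)

section \<open>Ports and runs of a pair of 2-factors\<close>

locale oriented_pair =
  fixes \<sigma> \<sigma>' :: "'a \<Rightarrow> 'a" and V W :: "'a set" and Hs H :: "'a graph"
  assumes finV: "finite V" and finW: "finite W"
    and oV: "cyclic_orientation \<sigma> V Hs" and oW: "cyclic_orientation \<sigma>' W H"
begin

abbreviation s :: "bool \<Rightarrow> 'a \<Rightarrow> 'a" where "s \<equiv> step \<sigma>"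

definition "S = H - Hs"

definition "T = \<Union>S"

text \<open>
  A port of \<open>v\<close> inside \<open>V\<close> is a direction along \<open>Hs\<close> whose edge is missing from \<open>H\<close>. Outside \<open>V\<close>,
  where \<open>s d\<close> is the identity, both directions are ports. In either case \<open>v\<close> has as many ports as
  edges of \<open>S\<close> (\<open>card_ports_at\<close>).
\<close>

definition ports :: "('a \<times> bool) set" where
  "ports = {(v, d). v \<in> T \<and> (v \<in> V \<longrightarrow> {v, s d v} \<notin> H)}"

text \<open>A run leaves a vertex touched by \<open>S\<close> and follows \<open>Hs\<close> to the
  next touched vertex. Outside \<open>V\<close>, where \<open>s d\<close> is the identity, its
  length is 1.\<close>

definition run :: "'a \<times> bool \<Rightarrow> nat" where
  "run q = (LEAST r. r \<ge> 1 \<and> (s (snd q) ^^ r) (fst q) \<in> T)"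

text \<open>The direction is flipped so that the far port looks back along the same run.\<close>

definition far :: "'a \<times> bool \<Rightarrow> 'a \<times> bool" where
  "far q = ((s (snd q) ^^ run q) (fst q), \<not> snd q)"

lemmas perm = cyclic_orientation_step(1)[OF oV]
lemmas step_back = cyclic_orientation_step(2)[OF oV]

lemma TW: "T \<subseteq> W"
  using cyclic_orientation_edge(2)[OF oW] by (auto simp: T_def S_def)

lemma HW: "v \<notin> W \<Longrightarrow> v \<in> e \<Longrightarrow> e \<notin> H"
  using cyclic_orientation_edge(2)[OF oW] by blast

lemma finH: "finite H"
  using oW finW by (auto simp: cyclic_orientation_def)

lemma finT: "finite T"
  using TW finW finite_subset by blast

lemma card_H_at: "v \<in> W \<Longrightarrow> card {e \<in> H. v \<in> e} = 2"
  using cyclic_orientation_step(4,5)[OF oW] by (simp add: card_image)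

text \<open>Inside \<open>V\<close>, both \<open>H\<close> and \<open>Hs\<close> have degree 2 at
  \<open>v\<close>, and removing the common edges leaves equally many on each side. Outside
  \<open>V\<close>, both edges of \<open>H\<close> at \<open>v\<close> lie in
  \<open>S\<close>.\<close>

lemma card_ports_at:
  assumes "v \<in> T"
  shows "card {d. (v, d) \<in> ports} = card {e \<in> S. v \<in> e}"
proof (cases "v \<in> V")
  case True
  let ?f = "\<lambda>d. {v, s d v}"
  have inj: "inj ?f" and r: "{e \<in> Hs. v \<in> e} = range ?f"
    using cyclic_orientation_step(4,5)[OF oV True] by auto
  have split: "{e \<in> H. v \<in> e} = {e \<in> S. v \<in> e} \<union> ?f ` {d. ?f d \<in> H}"
  proof
    show "{e \<in> H. v \<in> e} \<subseteq> {e \<in> S. v \<in> e} \<union> ?f ` {d. ?f d \<in> H}"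
    proof
      fix e assume e: "e \<in> {e \<in> H. v \<in> e}"
      show "e \<in> {e \<in> S. v \<in> e} \<union> ?f ` {d. ?f d \<in> H}"
      proof (cases "e \<in> Hs")
        case True
        then have "e \<in> range ?f" using r e by blast
        then show ?thesis using e by auto
      qed (use e in \<open>auto simp: S_def\<close>)
    qed
  qed (auto simp: S_def)
  have "{e \<in> S. v \<in> e} \<inter> ?f ` {d. ?f d \<in> H} = {}"
    using r by (auto simp: S_def)
  then have "2 = card {e \<in> S. v \<in> e} + card (?f ` {d. ?f d \<in> H})"
    using card_H_at[of v] assms TW finH by (subst card_Un_disjoint[symmetric]) (auto simp: split S_def)
  also have "card (?f ` {d. ?f d \<in> H}) = card {d. ?f d \<in> H}"
    using inj by (intro card_image) (auto intro: inj_on_subset)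
  finally have 1: "2 = card {e \<in> S. v \<in> e} + card {d. ?f d \<in> H}" .
  have "card (UNIV :: bool set) = card {d. ?f d \<in> H} + card {d. ?f d \<notin> H}"
    by (subst card_Un_disjoint[symmetric]) (auto simp: Collect_disj_eq[symmetric])
  moreover have "{d. ?f d \<notin> H} = {d. (v, d) \<in> ports}" using assms True by (auto simp: ports_def)
  ultimately show ?thesis using 1 by simp
next
  case False
  then have "{e \<in> S. v \<in> e} = {e \<in> H. v \<in> e}"
    using cyclic_orientation_edge(2)[OF oV] by (auto simp: S_def)
  moreover have "{d. (v, d) \<in> ports} = UNIV" using False assms by (auto simp: ports_def)
  ultimately show ?thesis using card_H_at[of v] assms TW by auto
qed

text \<open>An untouched vertex of \<open>W\<close> has both its \<open>H\<close>-edges among its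
  two \<open>Hs\<close>-edges, hence would keep both of these.\<close>

lemma removed_if_untouched:
  assumes "v \<in> V" "v \<notin> T" "{v, s d v} \<notin> H"
  shows "v \<notin> W"
proof
  assume "v \<in> W"
  let ?f = "\<lambda>d. {v, s d v}"
  have inj: "inj ?f" and r: "{e \<in> Hs. v \<in> e} = range ?f"
    using cyclic_orientation_step(4,5)[OF oV assms(1)] by auto
  have "{e \<in> H. v \<in> e} \<subseteq> {e \<in> Hs. v \<in> e} - {?f d}"
    using assms(2,3) by (auto simp: T_def S_def)
  moreover have "?f d \<in> {e \<in> Hs. v \<in> e}" using r by auto
  ultimately have "{e \<in> H. v \<in> e} \<subset> range ?f" using r by blast
  then have "card {e \<in> H. v \<in> e} < card (range ?f)" by (intro psubset_card_mono) auto
  then show False using card_H_at[OF \<open>v \<in> W\<close>] inj by (simp add: card_image)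
qed

lemma funpow_in_V: "(s d ^^ i) v \<in> V \<longleftrightarrow> v \<in> V"
  by (induction i) (auto simp: permutes_in_image[OF perm])

lemma funpow_outside: "v \<notin> V \<Longrightarrow> (s d ^^ i) v = v"
  by (induction i) (auto simp: permutes_not_in[OF perm])

lemma funpow_back: "j \<le> r \<Longrightarrow> (s (\<not> d) ^^ j) ((s d ^^ r) v) = (s d ^^ (r - j)) v"
proof (induction j)
  case (Suc j)
  then have "(s d ^^ (r - j)) v = s d ((s d ^^ (r - Suc j)) v)"
    by (metis Suc_diff_Suc Suc_le_lessD comp_apply funpow.simps(2))
  then show ?case using Suc step_back by simp
qed simp

text \<open>Some positive power of a permutation of a finite set is the identity, so the walk
  returns to a touched vertex and the minimum in \<open>run\<close> exists.\<close>

lemma run_spec: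
  assumes "fst q \<in> T"
  shows "run q \<ge> 1" "fst (far q) \<in> T"
    "\<And>i. 0 < i \<Longrightarrow> i < run q \<Longrightarrow> (s (snd q) ^^ i) (fst q) \<notin> T"
proof -
  obtain k where k: "k > 0" "(s (snd q) ^^ k) = id"
    using permutation_is_nilpotent permutation_permutes perm finV by metis
  then have "\<exists>r. r \<ge> 1 \<and> (s (snd q) ^^ r) (fst q) \<in> T" using assms by (intro exI[of _ k]) auto
  then have "run q \<ge> 1 \<and> (s (snd q) ^^ run q) (fst q) \<in> T" unfolding run_def by (rule LeastI_ex)
  then show "run q \<ge> 1" "fst (far q) \<in> T" by (auto simp: far_def)
  show "(s (snd q) ^^ i) (fst q) \<notin> T" if "0 < i" "i < run q" for i
    using that not_less_Least[of i "\<lambda>r. r \<ge> 1 \<and> (s (snd q) ^^ r) (fst q) \<in> T"]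
    by (auto simp: run_def)
qed

lemma run_eqI:
  assumes "r \<ge> 1" "(s d ^^ r) v \<in> T" "\<And>i. 0 < i \<Longrightarrow> i < r \<Longrightarrow> (s d ^^ i) v \<notin> T"
  shows "run (v, d) = r"
  unfolding run_def
proof (rule Least_equality)
  fix y assume "1 \<le> y \<and> (s (snd (v, d)) ^^ y) (fst (v, d)) \<in> T"
  then show "r \<le> y" using assms(3)[of y] by (cases "y < r") auto
qed (use assms in auto)

lemma run_outside: "v \<in> T \<Longrightarrow> v \<notin> V \<Longrightarrow> run (v, d) = 1"
  by (intro run_eqI) (auto simp: permutes_not_in[OF perm])

text \<open>Induction along the run: an untouched vertex entered through a missing edge is not in
  \<open>W\<close>, so the edge leaving it is missing too.\<close>

lemma run_removed_edges:
  assumes "(v, d) \<in> ports" "v \<in> V" "i < run (v, d)"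
  shows "{(s d ^^ i) v, (s d ^^ Suc i) v} \<notin> H \<and> (0 < i \<longrightarrow> (s d ^^ i) v \<notin> W)"
  using assms(3)
proof (induction i)
  case 0
  then show ?case using assms by (auto simp: ports_def)
next
  case (Suc i)
  let ?u = "(s d ^^ Suc i) v"
  have "?u \<notin> T" using run_spec(3)[of "(v, d)" "Suc i"] Suc.prems assms(1) by (auto simp: ports_def)
  moreover have "?u \<in> V" using assms(2) funpow_in_V by blast
  moreover have "{?u, s (\<not> d) ?u} \<notin> H" using Suc step_back by (simp add: insert_commute)
  ultimately have "?u \<notin> W" using removed_if_untouched by blast
  then show ?case using HW[of ?u] by auto
qed

text \<open>Inside \<open>V\<close> the last edge of a run is missing from \<open>H\<close>, so the
  run ends in a port. Walking back meets the same untouched interior vertices, so the return run has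
  the same length.\<close>

lemma far_involution:
  assumes "q \<in> ports"
  shows "far q \<in> ports" "far (far q) = q" "far q \<noteq> q"
proof -
  obtain v d where q: "q = (v, d)" by force
  define r where "r = run (v, d)"
  define w where "w = (s d ^^ r) v"
  have v: "v \<in> T" using assms q by (auto simp: ports_def)
  have r: "r \<ge> 1" "w \<in> T" "\<And>i. 0 < i \<Longrightarrow> i < r \<Longrightarrow> (s d ^^ i) v \<notin> T"
    using run_spec[of q] v by (auto simp: q r_def w_def far_def)
  have fq: "far q = (w, \<not> d)" by (simp add: far_def q r_def w_def)
  then show "far q \<noteq> q" by (simp add: q)
  have "{w, s (\<not> d) w} \<notin> H" if "w \<in> V"
  proof -
    obtain j where j: "r = Suc j" using r(1) by (cases r) auto
    have "v \<in> V" using that funpow_in_V by (simp add: w_def)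
    then have "{(s d ^^ j) v, w} \<notin> H"
      using run_removed_edges[of v d j] assms q j by (simp add: r_def w_def)
    moreover have "s (\<not> d) w = (s d ^^ j) v" using step_back by (simp add: w_def j)
    ultimately show ?thesis by (simp add: insert_commute)
  qed
  then show "far q \<in> ports" using r(2) by (auto simp: fq ports_def)
  have bk: "(s (\<not> d) ^^ i) w = (s d ^^ (r - i)) v" if "i \<le> r" for i
    using funpow_back[OF that] by (simp add: w_def)
  have "run (w, \<not> d) = r" using r v bk by (intro run_eqI) auto
  then show "far (far q) = q" using bk[of r] by (subst fq) (simp add: far_def q)
qed

lemma finite_ports: "finite ports"
  using finT by (intro finite_subset[of ports "T \<times> UNIV"]) (auto simp: ports_def)

text \<open>This lets the interior lengths of runs be added up without counting a removed vertex
  twice. The hypothesis on \<open>far\<close> excludes the same run taken from its other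
  end.\<close>

lemma intermediate_inj:
  assumes q: "(v, d) \<in> ports" "(v', d') \<in> ports" and far: "far (v, d) \<noteq> (v', d')"
    and i: "0 < i" "i < run (v, d)" and j: "0 < j" "j < run (v', d')"
    and eq: "(s d ^^ i) v = (s d' ^^ j) v'"
  shows "(v, d) = (v', d') \<and> i = j"
proof (cases "d = d'")
  case True
  \<comment> \<open>In equal directions, walking back from the common vertex meets one starting
    point inside the other run, unless the two starting points agree; but starting points are
    touched.\<close>
  have *: "i = j \<and> v = v'" if "i \<le> j" "0 < i" "j < run (v', d)" "v \<in> T" "v' \<in> T"
    "(s d ^^ i) v = (s d ^^ j) v'" for i j v v'
  proof -
    have e: "(s d ^^ (j - i)) v' = v"
      using funpow_back[of i j d v'] funpow_back[of i i d v] that by simp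
    have "i = j"
    proof (rule ccontr)
      assume "i \<noteq> j"
      then have "0 < j - i" "j - i < run (v', d)" using that by auto
      then show False using run_spec(3)[of "(v', d)" "j - i"] that e by auto
    qed
    then show ?thesis using e by simp
  qed
  have T: "v \<in> T" "v' \<in> T" using q by (auto simp: ports_def)
  show ?thesis using *[of i j v' v] *[of j i v v'] T i j eq True by (cases "i \<le> j") auto
next
  case False
  then have d': "d' = (\<not> d)" by auto
  \<comment> \<open>In opposite directions, the first walk continues past the common vertex by
    retracing the second, so both are the same run, of length \<open>i + j\<close>.\<close>
  have bk: "(s d ^^ k) v = (s d' ^^ (i + j - k)) v'" if "i \<le> k" "k \<le> i + j" for k
  proof -
    have "(s d ^^ k) v = (s d ^^ (k - i)) ((s d ^^ i) v)"
      using that by (metis comp_apply funpow_add le_add_diff_inverse2)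
    also have "\<dots> = (s d' ^^ (j - (k - i))) v'"
      using funpow_back[of "k - i" j d' v'] that by (simp add: eq d')
    also have "j - (k - i) = i + j - k" using that by simp
    finally show ?thesis .
  qed
  have T: "v \<in> T" "v' \<in> T" using q by (auto simp: ports_def)
  have "run (v, d) = i + j"
  proof (rule run_eqI)
    show "(s d ^^ (i + j)) v \<in> T" using bk[of "i + j"] T by simp
    fix k assume k: "0 < k" "k < i + j"
    show "(s d ^^ k) v \<notin> T"
    proof (cases "k \<le> i")
      case True
      then show ?thesis using run_spec(3)[of "(v, d)" k] T k i by auto
    next
      case False
      then show ?thesis using run_spec(3)[of "(v', d')" "i + j - k"] bk[of k] T k j by auto
    qed
  qed (use i in auto)
  then have "far (v, d) = (v', d')" using bk[of "i + j"] d' by (simp add: far_def)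
  then show ?thesis using far by simp
qed

text \<open>
  At every vertex the edges of \<open>S\<close> are matched arbitrarily with the ports; \<open>eps\<close> then moves to the
  port at the other end of the matched edge.
\<close>

lemma other_port_exists:
  obtains edge :: "'a \<times> bool \<Rightarrow> 'a set" and eps where
    "\<And>q. q \<in> ports \<Longrightarrow> eps q \<in> ports \<and> eps (eps q) = q \<and> eps q \<noteq> q"
    "\<And>q. q \<in> ports \<Longrightarrow> edge q = {fst q, fst (eps q)}"
    "edge ` ports = S"
    "\<And>q q'. q \<in> ports \<Longrightarrow> q' \<in> ports \<Longrightarrow> edge q = edge q' \<Longrightarrow> q' = q \<or> q' = eps q"
proof -
  have "\<exists>h. bij_betw h {d. (v, d) \<in> ports} {e \<in> S. v \<in> e}" if "v \<in> T" for v
    using card_ports_at[OF that] finH by (intro finite_same_card_bij) (auto simp: S_def)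
  then obtain h where h: "\<And>v. v \<in> T \<Longrightarrow> bij_betw (h v) {d. (v, d) \<in> ports} {e \<in> S. v \<in> e}"
    by metis
  define edge where "edge q = h (fst q) (snd q)" for q
  have e1: "edge q \<in> S \<and> fst q \<in> edge q" if "q \<in> ports" for q
  proof -
    have "fst q \<in> T" "snd q \<in> {d. (fst q, d) \<in> ports}" using that by (auto simp: ports_def)
    from bij_betw_apply[OF h[OF this(1)] this(2)] show ?thesis by (simp add: edge_def)
  qed
  have e2: "\<exists>d. (v, d) \<in> ports \<and> edge (v, d) = e" if "e \<in> S" "v \<in> e" for e v
  proof -
    have "v \<in> T" using that by (auto simp: T_def)
    then have "e \<in> h v ` {d. (v, d) \<in> ports}" using bij_betw_imp_surj_on[OF h] that by simp
    then show ?thesis by (auto simp: edge_def)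
  qed
  have e3: "q = q'" if "q \<in> ports" "q' \<in> ports" "edge q = edge q'" "fst q = fst q'" for q q'
  proof -
    have "fst q \<in> T" "(fst q, snd q) \<in> ports" "(fst q, snd q') \<in> ports"
      using that by (auto simp: ports_def split_beta)
    then have "inj_on (h (fst q)) {d. (fst q, d) \<in> ports}" using h by (simp add: bij_betw_def)
    then have "snd q = snd q'"
      by (rule inj_onD) (use that \<open>(fst q, snd q) \<in> ports\<close> \<open>(fst q, snd q') \<in> ports\<close> in \<open>auto simp: edge_def\<close>)
    then show ?thesis using that by (simp add: prod_eq_iff)
  qed
  have "\<exists>q'. q' \<in> ports \<and> q' \<noteq> q \<and> edge q' = edge q \<and> edge q = {fst q, fst q'} \<and> fst q \<noteq> fst q'"
    if q: "q \<in> ports" for q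
  proof -
    have "card (edge q) = 2" using e1[OF q] cyclic_orientation_edge(1)[OF oW] by (auto simp: S_def)
    then obtain w where w: "edge q = {fst q, w}" "w \<noteq> fst q"
      using e1[OF q] by (metis card_2_iff doubleton_eq_iff insertE singletonD)
    obtain d where "(w, d) \<in> ports" "edge (w, d) = edge q" using e2[of "edge q" w] e1[OF q] w by auto
    then show ?thesis using w by (intro exI[of _ "(w, d)"]) auto
  qed
  then obtain eps where eps: "\<And>q. q \<in> ports \<Longrightarrow> eps q \<in> ports \<and> eps q \<noteq> q \<and> edge (eps q) = edge q \<and>
      edge q = {fst q, fst (eps q)} \<and> fst q \<noteq> fst (eps q)"
    by metis
  have e4: "q' = q \<or> q' = eps q" if "q \<in> ports" "q' \<in> ports" "edge q = edge q'" for q q'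
  proof -
    have "fst q' = fst q \<or> fst q' = fst (eps q)" using e1[OF that(2)] eps[OF that(1)] that(3) by auto
    then show ?thesis using e3[of q' q] e3[of q' "eps q"] that eps[OF that(1)] by auto
  qed
  show thesis
  proof (rule that[of eps edge])
    show "eps q \<in> ports \<and> eps (eps q) = q \<and> eps q \<noteq> q" if "q \<in> ports" for q
      using e4[of q "eps (eps q)"] eps[of q] eps[of "eps q"] that by metis
    show "edge ` ports = S"
    proof
      show "edge ` ports \<subseteq> S" using e1 by auto
      show "S \<subseteq> edge ` ports"
      proof
        fix e assume e: "e \<in> S"
        then have "card e = 2" using cyclic_orientation_edge(1)[OF oW] by (auto simp: S_def)
        then obtain v where "v \<in> e" by (auto simp: card_2_iff)
        then show "e \<in> edge ` ports" using e2[OF e] by blast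
      qed
    qed
  qed (use eps e4 in blast)+
qed

end

section \<open>Encoding the new edges by words\<close>

text \<open>A letter \<open>(v, d, r)\<close> stands for a visit that enters at \<open>v\<close> and
  walks \<open>r\<close> steps in direction \<open>d\<close>.\<close>

type_synonym 'a letter = "'a \<times> bool \<times> nat"

definition exit :: "('a \<Rightarrow> 'a) \<Rightarrow> 'a letter \<Rightarrow> 'a" where
  "exit \<sigma> l = (case l of (v, d, r) \<Rightarrow> (step \<sigma> d ^^ r) v)"

definition weight :: "'a set \<Rightarrow> real \<Rightarrow> real \<Rightarrow> 'a letter \<Rightarrow> real" where
  "weight V p x l = (case l of (v, d, r) \<Rightarrow> if v \<in> V then p * x ^ (r - 1) else p / x)"

text \<open>A run of length \<open>r\<close> passes \<open>r - 1\<close> distinct removed vertices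
  of \<open>V\<close>, hence the bound \<open>Suc (card V)\<close>.\<close>

definition letters :: "'a set \<Rightarrow> 'a set \<Rightarrow> 'a letter set" where
  "letters U V = V \<times> UNIV \<times> {1..Suc (card V)} \<union> (U - V) \<times> {True} \<times> {1}"

text \<open>
  The word \<open>w\<close> encodes the permutation of its letters that sends the \<open>i\<close>-th letter of a fixed
  enumeration of \<open>set w\<close> to \<open>w ! i\<close>.
\<close>

definition decode :: "('a \<Rightarrow> 'a) \<Rightarrow> 'a letter list \<Rightarrow> 'a graph" where
  "decode \<sigma> w = (\<lambda>(l, l'). {exit \<sigma> l, fst l'}) ` set (zip (SOME ls. set ls = set w \<and> distinct ls) w)"

text \<open>The word lists the images of the enumerated letters. Its set of letters is again
  \<open>L\<close>, so \<open>decode\<close> picks the same enumeration and recovers the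
  permutation.\<close>

lemma decode_permutation:
  assumes "finite L" "bij_betw \<pi> L L"
  shows "\<exists>w. set w = L \<and> distinct w \<and> decode \<sigma> w = (\<lambda>l. {exit \<sigma> l, fst (\<pi> l)}) ` L"
proof -
  define ls where "ls = (SOME ls. set ls = L \<and> distinct ls)"
  have ls: "set ls = L" "distinct ls"
    using someI_ex[OF finite_distinct_list[OF assms(1)]] by (auto simp: ls_def)
  have w: "set (map \<pi> ls) = L" using assms(2) ls by (auto simp: bij_betw_def)
  moreover have "distinct (map \<pi> ls)" using assms(2) ls by (simp add: distinct_map bij_betw_def)
  moreover have "decode \<sigma> (map \<pi> ls) = (\<lambda>l. {exit \<sigma> l, fst (\<pi> l)}) ` L"
    unfolding decode_def w ls_def[symmetric]
    by (auto simp: zip_map2 zip_same_conv_map ls(1) image_image)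
  ultimately show ?thesis by blast
qed

context oriented_pair
begin

text \<open>A colouring of the ports that \<open>eps\<close> and \<open>far\<close> both switch
  selects one end of each run and of each edge of \<open>S\<close>. Walking a run and then crossing
  an edge permutes the selected ports; the word records this permutation.\<close>

lemma encoding:
  assumes card: "card V = card W" and U: "W \<subseteq> U" and p: "0 \<le> p" and x: "0 < x" "x \<le> 1"
  shows "\<exists>w. set w \<subseteq> letters U V \<and> length w = card S \<and> decode \<sigma> w = S \<and>
             p ^ card S \<le> prod_list (map (weight V p x) w)"
proof -
  obtain edge :: "'a \<times> bool \<Rightarrow> 'a set" and eps where
    eps: "\<And>q. q \<in> ports \<Longrightarrow> eps q \<in> ports \<and> eps (eps q) = q \<and> eps q \<noteq> q" and
    edge: "\<And>q. q \<in> ports \<Longrightarrow> edge q = {fst q, fst (eps q)}" "edge ` ports = S" and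
    edge_inj: "\<And>q q'. q \<in> ports \<Longrightarrow> q' \<in> ports \<Longrightarrow> edge q = edge q' \<Longrightarrow> q' = q \<or> q' = eps q"
    by (rule other_port_exists) (rule that)
  have "\<exists>c :: 'a \<times> bool \<Rightarrow> bool. \<forall>q\<in>ports. c (eps q) \<noteq> c q \<and> c (far q) \<noteq> c q"
    by (rule involutions_two_colouring[OF finite_ports eps]) (use far_involution in auto)
  then obtain c :: "'a \<times> bool \<Rightarrow> bool"
    where c: "\<And>q. q \<in> ports \<Longrightarrow> c (eps q) \<noteq> c q \<and> c (far q) \<noteq> c q"
    by blast
  define P where "P = {q \<in> ports. c q}"
  have finP: "finite P" using finite_ports by (simp add: P_def)
  \<comment> \<open>\<open>far\<close> walks to the end of the run and \<open>eps\<close> crosses an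
    edge of \<open>S\<close>. Each switches the colour, so \<open>nxt\<close> maps \<open>P\<close>
    to itself.\<close>
  define nxt where "nxt q = eps (far q)" for q
  have "eps (far q) \<in> P \<and> far (eps q) \<in> P \<and> far (eps (eps (far q))) = q \<and> eps (far (far (eps q))) = q"
    if "q \<in> P" for q
    using that eps[of q] eps[of "far q"] far_involution[of q] far_involution[of "eps q"]
      c[of q] c[of "far q"] c[of "eps q"] by (simp add: P_def)
  then have nxt: "bij_betw nxt P P"
    by (intro bij_betw_byWitness[where f' = "\<lambda>q. far (eps q)"]) (auto simp only: nxt_def)
  (* Outside V only one of the two ports is in P, so the direction can be normalised to True;
     this is what spares the letters outside V the factor 2. *)
  define letter where "letter q = (fst q, snd q \<or> fst q \<notin> V, run q)" for q
  have far_out: "far (v, d) = (v, \<not> d)" if "v \<notin> V" for v d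
    using that funpow_outside by (simp add: far_def)
  have inj: "inj_on letter P"
  proof (rule inj_onI)
    fix q q' assume q: "q \<in> P" "q' \<in> P" "letter q = letter q'"
    obtain v d d' where v: "q = (v, d)" "q' = (v, d')" using q(3) by (cases q; cases q') (auto simp: letter_def)
    show "q = q'"
    proof (cases "v \<in> V")
      case False
      have "d = d'"
      proof (rule ccontr)
        assume "d \<noteq> d'"
        then have "far q = q'" using far_out[OF False] v by auto
        then show False using c[of q] q by (simp add: P_def)
      qed
      then show ?thesis using v by simp
    qed (use q v in \<open>auto simp: letter_def\<close>)
  qed
  define L where "L = letter ` P"
  define \<pi> where "\<pi> l = letter (nxt (inv_into P letter l))" for l
  have \<pi>: "\<pi> (letter q) = letter (nxt q)" if "q \<in> P" for q using that inj by (simp add: \<pi>_def)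
  have "bij_betw letter P L" using inj by (simp add: bij_betw_def L_def)
  then have "bij_betw (letter \<circ> nxt \<circ> inv_into P letter) L L"
    using nxt by (blast intro: bij_betw_trans bij_betw_inv_into)
  moreover have "\<pi> = letter \<circ> nxt \<circ> inv_into P letter" by (auto simp: \<pi>_def)
  ultimately have "bij_betw \<pi> L L" by simp
  then obtain w where w: "set w = L" "distinct w" "decode \<sigma> w = (\<lambda>l. {exit \<sigma> l, fst (\<pi> l)}) ` L"
    using decode_permutation[of L \<pi> \<sigma>] finP by (auto simp: L_def)
  have ex: "exit \<sigma> (letter q) = fst (far q)" for q
    using funpow_outside by (cases "fst q \<in> V") (auto simp: exit_def letter_def far_def)
  have edge_nxt: "{exit \<sigma> (letter q), fst (\<pi> (letter q))} = edge (nxt q)" if "q \<in> P" for q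
  proof -
    have "far q \<in> ports" using that far_involution by (auto simp: P_def)
    then have "edge (nxt q) = {fst (nxt q), fst (far q)}"
      using edge(1)[of "nxt q"] eps[of "far q"] by (simp add: nxt_def)
    moreover have "fst (\<pi> (letter q)) = fst (nxt q)" unfolding \<pi>[OF that] by (simp add: letter_def)
    ultimately show ?thesis by (simp only: ex insert_commute)
  qed
  have edgeP: "edge ` P = S"
  proof
    show "edge ` P \<subseteq> S" using edge(2) by (auto simp: P_def)
    have "edge q \<in> edge ` P" if q: "q \<in> ports" for q
    proof (cases "c q")
      case False
      have "edge (eps q) = edge q" using edge(1)[OF q] edge(1)[of "eps q"] eps[OF q] by auto
      moreover have "eps q \<in> P" using False c[OF q] eps[OF q] by (auto simp: P_def)
      ultimately show ?thesis by (metis imageI)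
    qed (use q in \<open>auto simp: P_def\<close>)
    then show "S \<subseteq> edge ` P" unfolding edge(2)[symmetric] by blast
  qed
  have "decode \<sigma> w = (\<lambda>q. edge (nxt q)) ` P"
    unfolding w(3) L_def image_image by (rule image_cong[OF refl edge_nxt])
  also have "\<dots> = edge ` P" using nxt by (metis bij_betw_imp_surj_on image_image)
  finally have dec: "decode \<sigma> w = S" using edgeP by simp
  have "inj_on edge P"
  proof (rule inj_onI)
    fix q q' assume "q \<in> P" "q' \<in> P" "edge q = edge q'"
    then show "q = q'" using edge_inj[of q q'] c[of q] by (auto simp: P_def)
  qed
  then have cardS: "card S = card P" using card_image[of edge P] edgeP by simp
  have len: "length w = card S"
    using distinct_card[OF w(2)] unfolding w(1) L_def card_image[OF inj] cardS by simp
  \<comment> \<open>Interior vertices of runs are removed vertices. None is counted twice, since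
    \<open>far\<close> takes a selected port to an unselected one.\<close>
  have runs: "(\<Sum>q\<in>P. run q - 1) \<le> card (V - W)"
  proof -
    let ?X = "SIGMA q:P. {0<..<run q}"
    let ?f = "\<lambda>(q, i). (s (snd q) ^^ i) (fst q)"
    have "inj_on ?f ?X"
    proof (rule inj_onI)
      fix a b assume ab: "a \<in> ?X" "b \<in> ?X" "?f a = ?f b"
      obtain v d i v' d' j where e: "a = ((v, d), i)" "b = ((v', d'), j)" by (metis surj_pair)
      have "far (v, d) \<noteq> (v', d')" using ab e c[of "(v, d)"] by (auto simp: P_def)
      then show "a = b" using intermediate_inj[of v d v' d' i j] ab e by (auto simp: P_def)
    qed
    moreover have "?f a \<in> V - W" if "a \<in> ?X" for a
    proof -
      obtain v d i where e: "a = ((v, d), i)" by (metis surj_pair)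
      have vd: "(v, d) \<in> ports" "0 < i" "i < run (v, d)" using that e by (auto simp: P_def)
      then have "v \<in> V" using run_outside[of v d] by (cases "v \<in> V") (auto simp: ports_def)
      then show ?thesis using run_removed_edges[OF vd(1) _ vd(3)] vd(2) funpow_in_V e by auto
    qed
    ultimately have "card ?X \<le> card (V - W)"
      using finV by (intro card_inj_on_le[of ?f]) auto
    then show ?thesis using finP by simp
  qed
  also have "card (V - W) = card (W - V)"
    using card finV finW by (simp add: card_Diff_subset_Int Int_commute)
  \<comment> \<open>An added vertex has its \<open>H\<close>-edges in \<open>S\<close>, so both
    directions are ports there, and \<open>far\<close> exchanges them; hence one is
    selected.\<close>
  also have "\<dots> \<le> card {q \<in> P. fst q \<notin> V}"
  proof -
    have "W - V \<subseteq> fst ` {q \<in> P. fst q \<notin> V}"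
    proof
      fix v assume v: "v \<in> W - V"
      have "card {e \<in> H. v \<in> e} = 2" using card_H_at v by simp
      then have "{e \<in> H. v \<in> e} \<noteq> {}" by (metis card.empty zero_neq_numeral)
      then obtain e where "e \<in> H" "v \<in> e" by blast
      moreover have "e \<notin> Hs" using cyclic_orientation_edge(2)[OF oV] v calculation by blast
      ultimately have "v \<in> T" by (auto simp: T_def S_def)
      then have port: "(v, d) \<in> ports" for d using v by (auto simp: ports_def)
      have "c (v, True) \<or> c (v, False)" using c[OF port[of True]] far_out[of v True] v by auto
      then obtain d where "(v, d) \<in> P" using port by (auto simp: P_def)
      then show "v \<in> fst ` {q \<in> P. fst q \<notin> V}" using v by force
    qed
    moreover have "finite {q \<in> P. fst q \<notin> V}" using finP by simp
    ultimately show ?thesis by (rule surj_card_le[rotated])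
  qed
  finally have balance: "(\<Sum>q\<in>P. run q - 1) \<le> card {q \<in> P. fst q \<notin> V}" .
  have "letter q \<in> letters U V" if q: "q \<in> P" for q
  proof (cases "fst q \<in> V")
    case True
    have "run q - 1 \<le> (\<Sum>q\<in>P. run q - 1)" using q finP by (intro member_le_sum) auto
    also have "\<dots> \<le> card V" using runs finV by (meson Diff_subset card_mono le_trans)
    finally show ?thesis using True run_spec(1)[of q] q by (auto simp: letter_def letters_def P_def ports_def)
  next
    case False
    then have "fst q \<in> T" using q by (auto simp: P_def ports_def)
    then show ?thesis using False run_outside[of "fst q" "snd q"] TW U by (auto simp: letter_def letters_def)
  qed
  then have sub: "set w \<subseteq> letters U V" by (auto simp: w(1) L_def)
  have "prod_list (map (weight V p x) w) = (\<Prod>l\<in>L. weight V p x l)"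
    using w(1,2) by (metis prod.distinct_set_conv_list)
  also have "\<dots> = (\<Prod>q\<in>P. weight V p x (letter q))"
    unfolding L_def using inj by (simp add: prod.reindex)
  \<comment> \<open>Outside \<open>V\<close> runs have length 1, so one formula covers both kinds of
    letters.\<close>
  also have "\<dots> = (\<Prod>q\<in>P. p * x ^ (run q - 1) / x ^ (if fst q \<in> V then 0 else 1))"
  proof (rule prod.cong)
    fix q assume "q \<in> P"
    then have "fst q \<in> T" by (auto simp: P_def ports_def)
    then show "weight V p x (letter q) = p * x ^ (run q - 1) / x ^ (if fst q \<in> V then 0 else 1)"
      using run_outside[of "fst q" "snd q"] by (auto simp: weight_def letter_def)
  qed simp
  also have "\<dots> = p ^ card P * x ^ (\<Sum>q\<in>P. run q - 1) / x ^ (\<Sum>q\<in>P. if fst q \<in> V then 0 else 1)"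
    by (simp add: prod_dividef prod.distrib power_sum)
  also have "(\<Sum>q\<in>P. if fst q \<in> V then 0 else 1) = card {q \<in> P. fst q \<notin> V}"
    using finP by (simp add: sum.If_cases Collect_conj_eq[symmetric] Int_def Compl_eq)
  finally have pl: "prod_list (map (weight V p x) w) =
      p ^ card P * (x ^ (\<Sum>q\<in>P. run q - 1) / x ^ card {q \<in> P. fst q \<notin> V})" by simp
  \<comment> \<open>By \<open>balance\<close>, the exponent of \<open>x\<close> in the numerator is
    at most that in the denominator, and \<open>x \<le> 1\<close>.\<close>
  have "x ^ card {q \<in> P. fst q \<notin> V} \<le> x ^ (\<Sum>q\<in>P. run q - 1)"
    using balance x by (intro power_decreasing) auto
  then have "1 \<le> x ^ (\<Sum>q\<in>P. run q - 1) / x ^ card {q \<in> P. fst q \<notin> V}" using x by simp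
  then have "p ^ card S \<le> prod_list (map (weight V p x) w)"
    using mult_left_mono[OF _ zero_le_power[OF p], of 1 _ "card P"] unfolding pl cardS by fastforce
  then show ?thesis using sub len dec by blast
qed

end

section \<open>Total weight of words and the sum over exchanges\<close>

lemma sum_prod_list_lists:
  fixes f :: "'a \<Rightarrow> 'b :: comm_semiring_1"
  assumes "finite A"
  shows "(\<Sum>xs | set xs \<subseteq> A \<and> length xs = k. prod_list (map f xs)) = sum f A ^ k"
proof (induction k)
  case 0
  have "{xs. set xs \<subseteq> A \<and> length xs = 0} = {[]}" by auto
  then show ?case by simp
next
  case (Suc k)
  have "(\<Sum>xs | set xs \<subseteq> A \<and> length xs = Suc k. prod_list (map f xs)) =
      (\<Sum>(xs, a) \<in> {xs. set xs \<subseteq> A \<and> length xs = k} \<times> A. f a * prod_list (map f xs))"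
    unfolding lists_length_Suc_eq by (subst sum.reindex) (auto simp: inj_on_def case_prod_unfold)
  also have "\<dots> = (\<Sum>xs | set xs \<subseteq> A \<and> length xs = k. sum f A * prod_list (map f xs))"
    by (subst sum.cartesian_product[symmetric]) (simp add: sum_distrib_right)
  finally show ?case using Suc by (simp add: sum_distrib_left[symmetric])
qed

text \<open>For each vertex of \<open>V\<close> and each of the two directions, the run lengths give
  part of a geometric series.\<close>

lemma sum_weight_letters_le:
  assumes "finite U" "V \<subseteq> U" "0 \<le> p" "0 < x" "x < 1"
  shows "(\<Sum>l\<in>letters U V. weight V p x l) \<le>
    real (card V) * (2 * p / (1 - x)) + (real (card U) - real (card V)) * (p / x)"
proof -
  have finV: "finite V" using assms finite_subset by blast
  have "(\<Sum>l\<in>letters U V. weight V p x l) =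
      (\<Sum>l\<in>V \<times> UNIV \<times> {1..Suc (card V)}. weight V p x l) +
      (\<Sum>l\<in>(U - V) \<times> {True} \<times> {1}. weight V p x l)"
    unfolding letters_def using assms(1) finV by (intro sum.union_disjoint) auto
  also have "(\<Sum>l\<in>V \<times> UNIV \<times> {1..Suc (card V)}. weight V p x l) =
      (\<Sum>v\<in>V. \<Sum>d\<in>(UNIV :: bool set). \<Sum>r\<in>{1..Suc (card V)}. p * x ^ (r - 1))"
    unfolding sum.cartesian_product by (rule sum.cong) (auto simp: weight_def)
  also have "\<dots> = real (card V) * (2 * (p * (\<Sum>r\<in>{1..Suc (card V)}. x ^ (r - 1))))"
    by (simp only: sum_distrib_left[symmetric] sum_constant card_UNIV_bool of_nat_numeral mult_ac)
  also have "(\<Sum>r\<in>{1..Suc (card V)}. x ^ (r - 1)) = (\<Sum>r<Suc (card V). x ^ r)"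
    by (rule sum.reindex_bij_witness[of _ Suc "\<lambda>r. r - 1"]) auto
  also have "(\<Sum>l\<in>(U - V) \<times> {True} \<times> {1}. weight V p x l) = (\<Sum>l\<in>(U - V) \<times> {True} \<times> {1::nat}. p / x)"
    by (rule sum.cong) (auto simp: weight_def)
  also have "\<dots> = real (card (U - V)) * (p / x)"
    by (simp add: card_cartesian_product)
  also have "real (card (U - V)) = real (card U) - real (card V)"
    using assms finV by (simp add: card_Diff_subset of_nat_diff card_mono)
  finally have e: "(\<Sum>l\<in>letters U V. weight V p x l) =
    real (card V) * (2 * (p * (\<Sum>r<Suc (card V). x ^ r))) + (real (card U) - real (card V)) * (p / x)" .
  have "(\<Sum>r<Suc (card V). x ^ r) \<le> 1 / (1 - x)"
    using assms sum_le_suminf[of "\<lambda>r. x ^ r" "{..<Suc (card V)}"] suminf_geometric[of x]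
    by (auto intro: summable_geometric)
  then have "p * (\<Sum>r<Suc (card V). x ^ r) \<le> p * (1 / (1 - x))" using assms(3) by (rule mult_left_mono)
  then have "real (card V) * (2 * (p * (\<Sum>r<Suc (card V). x ^ r))) \<le> real (card V) * (2 * p / (1 - x))"
    by (intro mult_left_mono) auto
  then show ?thesis unfolding e by simp
qed

text \<open>These are the possible sets of new edges; each counts once, however many
  \<open>H\<close> produce it.\<close>

definition exchanges :: "'a set \<Rightarrow> 'a set \<Rightarrow> 'a graph \<Rightarrow> 'a graph set" where
  "exchanges U V Hs = {H - Hs | H W. W \<subseteq> U \<and> card W = card V \<and> two_factor_on W H}"

lemma exchanges_edge:
  assumes "S \<in> exchanges U V Hs" "e \<in> S"
  shows "e \<subseteq> U" "card e = 2"
proof -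
  obtain H W where H: "S = H - Hs" "W \<subseteq> U" "two_factor_on W H"
    using assms(1) by (auto simp: exchanges_def)
  obtain \<sigma> where \<sigma>: "cyclic_orientation \<sigma> W H" using two_factor_orientation[OF H(3)] by blast
  have "e \<in> H" using assms(2) H(1) by blast
  then show "e \<subseteq> U" "card e = 2" using cyclic_orientation_edge[OF \<sigma>] H(2) by blast+
qed

lemma exchanges_subset: "exchanges U V Hs \<subseteq> Pow (Pow U)"
  using exchanges_edge(1) by blast

text \<open>Since \<open>decode\<close> recovers \<open>S\<close>, the encoding is injective, so the
  sum is at most one over all words. Those of length \<open>k\<close> contribute \<open>k\<close>
  times the \<open>k\<close>-th power of the total letter weight.\<close>

lemma sum_exchanges_le:
  assumes U: "finite U" "V \<subseteq> U" and Hs: "two_factor_on V Hs"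
    and p: "0 \<le> p" and x: "0 < x" "x < 1"
    and \<rho>: "real (card V) * (2 * p / (1 - x)) + (real (card U) - real (card V)) * (p / x) \<le> \<rho>" "\<rho> < 1"
  shows "(\<Sum>S\<in>exchanges U V Hs. real (card S) * p ^ card S) \<le> 1 / (1 - \<rho>)\<^sup>2"
proof -
  let ?A = "letters U V" and ?f = "weight V p x"
  obtain \<sigma> where \<sigma>: "cyclic_orientation \<sigma> V Hs" using two_factor_orientation[OF Hs] by blast
  have finV: "finite V" using U finite_subset by blast
  have finA: "finite ?A" using U finV by (simp add: letters_def)
  have f0: "0 \<le> ?f l" for l using p x by (auto simp: weight_def split: prod.split)
  have sum0: "0 \<le> sum ?f ?A" using f0 by (rule sum_nonneg)
  have "\<exists>w. set w \<subseteq> ?A \<and> length w = card S \<and> decode \<sigma> w = S \<and> p ^ card S \<le> prod_list (map ?f w)"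
    if S: "S \<in> exchanges U V Hs" for S
  proof -
    obtain H W where H: "S = H - Hs" "W \<subseteq> U" "card W = card V" "two_factor_on W H"
      using S by (auto simp: exchanges_def)
    obtain \<sigma>' where "cyclic_orientation \<sigma>' W H" using two_factor_orientation[OF H(4)] by blast
    then interpret oriented_pair \<sigma> \<sigma>' V W Hs H
      using \<sigma> finV U H(2) by unfold_locales (auto intro: finite_subset)
    show ?thesis using encoding[of U p x] H p x by (simp add: S_def)
  qed
  then obtain w where w: "\<And>S. S \<in> exchanges U V Hs \<Longrightarrow> set (w S) \<subseteq> ?A \<and> length (w S) = card S \<and>
      decode \<sigma> (w S) = S \<and> p ^ card S \<le> prod_list (map ?f (w S))"
    by metis
  have pl0: "0 \<le> prod_list (map ?f u)" for u using f0 by (induction u) auto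
  \<comment> \<open>A crude bound on the word length keeps the sum over words finite.\<close>
  define K where "K = card (Pow U)"
  have inj: "inj_on w (exchanges U V Hs)" using w by (metis inj_onI)
  have "card S \<le> K" if "S \<in> exchanges U V Hs" for S
    using that exchanges_subset[of U V Hs] U unfolding K_def by (intro card_mono) auto
  then have sub: "w ` exchanges U V Hs \<subseteq> (\<Union>k\<in>{..K}. {u. set u \<subseteq> ?A \<and> length u = k})"
    using w by fastforce
  have fin: "finite {u. set u \<subseteq> ?A \<and> length u = k}" for k using finA by (rule finite_lists_length_eq)
  have "(\<Sum>S\<in>exchanges U V Hs. real (card S) * p ^ card S) \<le>
      (\<Sum>S\<in>exchanges U V Hs. real (length (w S)) * prod_list (map ?f (w S)))"
    using w by (intro sum_mono) (simp add: mult_left_mono)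
  also have "\<dots> = (\<Sum>u\<in>w ` exchanges U V Hs. real (length u) * prod_list (map ?f u))"
    using inj by (simp add: sum.reindex)
  also have "\<dots> \<le> (\<Sum>u\<in>(\<Union>k\<in>{..K}. {u. set u \<subseteq> ?A \<and> length u = k}). real (length u) * prod_list (map ?f u))"
    using sub fin pl0 by (intro sum_mono2) auto
  also have "\<dots> = (\<Sum>k\<le>K. \<Sum>u | set u \<subseteq> ?A \<and> length u = k. real (length u) * prod_list (map ?f u))"
    using fin by (subst sum.UNION_disjoint) auto
  also have "\<dots> = (\<Sum>k\<le>K. real k * sum ?f ?A ^ k)"
    unfolding sum_prod_list_lists[OF finA, symmetric] by (simp add: sum_distrib_left)
  \<comment> \<open>The factor \<open>Suc k\<close> matches the derivative of the geometric
    series.\<close>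
  also have "\<dots> \<le> (\<Sum>k\<le>K. real (Suc k) * \<rho> ^ k)"
    using sum_weight_letters_le[OF U p x] \<rho> sum0
    by (intro sum_mono mult_mono power_mono zero_le_power) auto
  also have "\<dots> \<le> 1 / (1 - \<rho>)\<^sup>2"
  proof -
    have "0 \<le> \<rho>" using sum_weight_letters_le[OF U p x] \<rho> sum0 by linarith
    then have "(\<lambda>k. real (Suc k) * \<rho> ^ k) sums (1 / (1 - \<rho>)\<^sup>2)"
      using geometric_deriv_sums[of \<rho>] \<rho> by simp
    then show ?thesis using sum_le_suminf[of "\<lambda>k. real (Suc k) * \<rho> ^ k" "{..K}"] \<open>0 \<le> \<rho>\<close>
      by (simp add: sums_iff)
  qed
  finally show ?thesis .
qed

section \<open>The random graph and the expected difference\<close>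

lemma finite_complete_edges: "finite (complete_edges n)"
  by (rule finite_subset[of _ "Pow {1..n}"]) (auto simp: complete_edges_def)

lemma set_pmf_erdos_renyi: "set_pmf (erdos_renyi n p) \<subseteq> Pow (complete_edges n)"
  by (auto simp: erdos_renyi_def)

lemma prob_erdos_renyi_superset:
  assumes "S \<subseteq> complete_edges n" "0 \<le> p" "p \<le> 1"
  shows "measure_pmf.prob (erdos_renyi n p) {G. S \<subseteq> G} = p ^ card S"
proof -
  let ?E = "complete_edges n"
  have "(\<lambda>X. {e \<in> ?E. X e}) -` {G. S \<subseteq> G} = Pi ?E (\<lambda>e. if e \<in> S then {True} else UNIV)"
    using assms(1) by (auto simp: Pi_def)
  then have "measure_pmf.prob (erdos_renyi n p) {G. S \<subseteq> G} =
      (\<Prod>e\<in>?E. measure_pmf.prob (bernoulli_pmf p) (if e \<in> S then {True} else UNIV))"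
    by (simp add: erdos_renyi_def measure_Pi_pmf_Pi finite_complete_edges)
  also have "\<dots> = (\<Prod>e\<in>?E. if e \<in> S then p else 1)"
    using assms by (intro prod.cong) (auto simp: measure_pmf_single)
  also have "\<dots> = p ^ card S"
    using assms(1) finite_complete_edges[of n] by (simp add: prod.If_cases Int_absorb1)
  finally show ?thesis .
qed

text \<open>The difference is dominated pointwise by a sum over all exchanges contained in the
  random part, the actual one being among the summands. That sum does not involve \<open>H\<close>,
  so \<open>H\<close> may depend on \<open>G\<close> in any way.\<close>

lemma expectation_difference_le:
  assumes Hs: "Hs \<in> two_factors_in (complete_edges n) m"
    and H: "\<And>G. G \<in> set_pmf (planted_cycles_given n lam Hs) \<Longrightarrow> H G \<in> two_factors_in G m"
    and p: "0 \<le> lam / real n" "lam / real n \<le> 1"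
    and x: "0 < x" "x < 1"
    and \<rho>: "real m * (2 * (lam / real n) / (1 - x)) + (real n - real m) * (lam / real n / x) \<le> \<rho>" "\<rho> < 1"
  shows "measure_pmf.expectation (planted_cycles_given n lam Hs)
           (\<lambda>G. real (card (sym_diff Hs (H G)))) \<le> 2 / (1 - \<rho>)\<^sup>2"
proof -
  define p where "p = lam / real n"
  let ?U = "{1..n}" and ?ER = "erdos_renyi n p"
  have sub2: "W \<subseteq> {1..n}" if "F \<subseteq> complete_edges n" "two_factor_on W F" for F W
    using that by (auto simp: two_factor_on_def complete_edges_def)
  obtain V where V: "card V = m" "two_factor_on V Hs" "Hs \<subseteq> complete_edges n"
    using Hs by (auto simp: two_factors_in_def)
  have VU: "V \<subseteq> ?U" using sub2 V by blast
  let ?\<S> = "exchanges ?U V Hs"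
  have fin\<S>: "finite ?\<S>" using exchanges_subset[of ?U V Hs] by (rule finite_subset) simp
  have finER: "finite (set_pmf ?ER)"
    using set_pmf_erdos_renyi by (rule finite_subset) (simp add: finite_complete_edges)
  have key: "real (card (sym_diff Hs (H (G \<union> Hs)))) \<le> (\<Sum>S\<in>?\<S>. 2 * real (card S) * indicator {G. S \<subseteq> G} G)"
    if G: "G \<in> set_pmf ?ER" for G
  proof -
    have sp: "G \<union> Hs \<in> set_pmf (planted_cycles_given n lam Hs)"
      using G by (auto simp: planted_cycles_given_def p_def)
    obtain W where W: "card W = m" "two_factor_on W (H (G \<union> Hs))" "H (G \<union> Hs) \<subseteq> G \<union> Hs"
      using H[OF sp] by (auto simp: two_factors_in_def)
    define S where "S = H (G \<union> Hs) - Hs"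
    have sub: "H (G \<union> Hs) \<subseteq> complete_edges n" using W(3) V(3) G set_pmf_erdos_renyi by blast
    have S: "S \<in> ?\<S>" using W V sub2[OF sub W(2)] by (auto simp: exchanges_def S_def)
    have fin: "finite Hs" "finite (H (G \<union> Hs))"
      using sub V(3) finite_complete_edges finite_subset by blast+
    \<comment> \<open>Equally many edges in both 2-factors make the lost edges as many as the new
      ones, which gives the factor 2.\<close>
    have "card Hs = card (H (G \<union> Hs))"
      using V W two_factor_orientation cyclic_orientation_card by metis
    then have "card (Hs - H (G \<union> Hs)) = card S"
      using fin by (simp add: card_Diff_subset_Int Int_commute S_def)
    moreover have "card (sym_diff Hs (H (G \<union> Hs))) = card (Hs - H (G \<union> Hs)) + card S"
      unfolding S_def using fin by (intro card_Un_disjoint) auto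
    ultimately have "real (card (sym_diff Hs (H (G \<union> Hs)))) = 2 * real (card S) * indicator {G. S \<subseteq> G} G"
      using W(3) by (auto simp: S_def indicator_def)
    also have "\<dots> \<le> (\<Sum>S\<in>?\<S>. 2 * real (card S) * indicator {G. S \<subseteq> G} G)"
      using S fin\<S> by (intro member_le_sum) auto
    finally show ?thesis .
  qed
  have "measure_pmf.expectation (planted_cycles_given n lam Hs) (\<lambda>G. real (card (sym_diff Hs (H G)))) =
      measure_pmf.expectation ?ER (\<lambda>G. real (card (sym_diff Hs (H (G \<union> Hs)))))"
    by (simp add: planted_cycles_given_def p_def)
  also have "\<dots> \<le> measure_pmf.expectation ?ER (\<lambda>G. \<Sum>S\<in>?\<S>. 2 * real (card S) * indicator {G. S \<subseteq> G} G)"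
    using key finER by (intro integral_mono_AE integrable_measure_pmf_finite) (auto simp: AE_measure_pmf_iff)
  also have "\<dots> = (\<Sum>S\<in>?\<S>. 2 * real (card S) * measure_pmf.prob ?ER {G. S \<subseteq> G})"
    using finER by (subst Bochner_Integration.integral_sum) (auto intro: integrable_measure_pmf_finite)
  also have "\<dots> = (\<Sum>S\<in>?\<S>. 2 * real (card S) * p ^ card S)"
  proof (rule sum.cong)
    fix S assume "S \<in> ?\<S>"
    then have "S \<subseteq> complete_edges n"
      using exchanges_edge unfolding complete_edges_def by blast
    then show "2 * real (card S) * measure_pmf.prob ?ER {G. S \<subseteq> G} = 2 * real (card S) * p ^ card S"
      using p prob_erdos_renyi_superset by (simp add: p_def)
  qed simp
  also have "\<dots> = 2 * (\<Sum>S\<in>?\<S>. real (card S) * p ^ card S)" by (simp add: sum_distrib_left mult.assoc)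
  also have "\<dots> \<le> 2 * (1 / (1 - \<rho>)\<^sup>2)"
    using sum_exchanges_le[OF _ VU V(2), of p x \<rho>] p x \<rho> V by (simp add: p_def)
  finally show ?thesis by simp
qed

section \<open>The threshold and the uniform constant\<close>

lemma threshold_weight:
  fixes \<delta> lam :: real
  assumes "0 < \<delta>" "\<delta> \<le> 1" "0 < lam" "lam < 1 / (sqrt (2 * \<delta>) + sqrt (1 - \<delta>))\<^sup>2"
  shows "\<exists>x. 0 < x \<and> x < 1 \<and> lam * (2 * \<delta> / (1 - x) + (1 - \<delta>) / x) < 1"
proof -
  define a b where "a = sqrt (2 * \<delta>)" and "b = sqrt (1 - \<delta>)"
  have a: "a > 0" "a\<^sup>2 = 2 * \<delta>" and b: "b \<ge> 0" "b\<^sup>2 = 1 - \<delta>"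
    using assms by (auto simp: a_def b_def)
  have "lam < 1 / (a + b)\<^sup>2" "0 < (a + b)\<^sup>2"
    using assms(4) a(1) b(1) by (simp_all only: a_def b_def zero_less_power add_pos_nonneg)
  then have lam: "lam * (a + b)\<^sup>2 < 1" by (simp add: pos_less_divide_eq)
  show ?thesis
  proof (cases "\<delta> = 1")
    case True
    then have "b = 0" by (simp add: b_def)
    then have l: "2 * lam < 1" using lam a True by simp
    \<comment> \<open>Every positive \<open>x\<close> below \<open>1 - 2 * lam\<close> works; half
      of this value is taken.\<close>
    have "lam * (2 / (1 - (1 - 2 * lam) / 2)) < 1" using l assms(3) by (simp add: field_simps)
    then show ?thesis using l assms(3) True by (intro exI[of _ "(1 - 2 * lam) / 2"]) auto
  next
    case False
    then have b': "b > 0" using assms by (simp add: b_def)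
    \<comment> \<open>At \<open>x = b / (a + b)\<close> the two terms become
      \<open>a * (a + b)\<close> and \<open>b * (a + b)\<close>.\<close>
    have "1 - b / (a + b) = a / (a + b)" using a b' by (simp add: field_simps)
    moreover have "2 * \<delta> = a * a" "1 - \<delta> = b * b" using a b by (simp_all add: power2_eq_square)
    ultimately have "2 * \<delta> / (1 - b / (a + b)) + (1 - \<delta>) / (b / (a + b)) = (a + b)\<^sup>2"
      using a(1) b' by (simp only:) (simp add: field_simps power2_eq_square)
    then show ?thesis using lam a b' by (intro exI[of _ "b / (a + b)"]) auto
  qed
qed

theorem theorem2:
  fixes \<delta> lam :: real
  assumes "0 < \<delta>" and "\<delta> \<le> 1"
    and "0 < lam" and "lam < 1 / (sqrt (2 * \<delta>) + sqrt (1 - \<delta>))\<^sup>2"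
  shows "\<exists>C::real. \<forall>n\<ge>1. \<forall>Hstar \<in> two_factors_in (complete_edges n) (planted_size \<delta> n).
           \<forall>H :: nat graph \<Rightarrow> nat graph.
             (\<forall>G \<in> set_pmf (planted_cycles_given n lam Hstar).
                H G \<in> two_factors_in G (planted_size \<delta> n)) \<longrightarrow>
             measure_pmf.expectation (planted_cycles_given n lam Hstar)
               (\<lambda>G. real (card (sym_diff Hstar (H G)))) \<le> C"
proof -
  obtain x where x: "0 < x" "x < 1" and thr: "lam * (2 * \<delta> / (1 - x) + (1 - \<delta>) / x) < 1"
    using threshold_weight[OF assms] by blast
  define \<rho>0 where "\<rho>0 = lam * (2 * \<delta> / (1 - x) + (1 - \<delta>) / x)"
  \<comment> \<open>The gap between \<open>\<rho>0\<close> and \<open>\<rho>\<close> absorbs the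
    rounding in \<open>planted_size\<close>, which costs at most
    \<open>lam / x / real n\<close>.\<close>
  define \<rho> where "\<rho> = (1 + \<rho>0) / 2"
  have \<rho>: "\<rho> < 1" "\<rho>0 < \<rho>" using thr by (auto simp: \<rho>_def \<rho>0_def)
  \<comment> \<open>From \<open>N\<close> on, \<open>lam / real n\<close> is at most 1 and the
    rounding error is at most \<open>\<rho> - \<rho>0\<close>.\<close>
  define N where "N = nat \<lceil>max lam (lam / x / (\<rho> - \<rho>0))\<rceil>"
  have large: "measure_pmf.expectation (planted_cycles_given n lam Hs)
      (\<lambda>G. real (card (sym_diff Hs (H G)))) \<le> 2 / (1 - \<rho>)\<^sup>2"
    if n: "n \<ge> 1" "n \<ge> N" and Hs: "Hs \<in> two_factors_in (complete_edges n) (planted_size \<delta> n)"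
      and H: "\<forall>G \<in> set_pmf (planted_cycles_given n lam Hs). H G \<in> two_factors_in G (planted_size \<delta> n)"
    for n Hs H
  proof (rule expectation_difference_le[OF Hs _ _ _ x])
    let ?m = "real (planted_size \<delta> n)"
    have "max lam (lam / x / (\<rho> - \<rho>0)) \<le> real n" using n by (simp add: N_def)
    then have nl: "lam \<le> real n" "lam / x / (\<rho> - \<rho>0) \<le> real n" by auto
    show "lam / real n \<le> 1" "0 \<le> lam / real n" using nl n assms(3) by auto
    have m: "?m \<le> \<delta> * real n" "\<delta> * real n - 1 \<le> ?m"
      using assms(1) by (auto simp: planted_size_def)
    have "?m * (2 * (lam / real n) / (1 - x)) \<le> \<delta> * real n * (2 * (lam / real n) / (1 - x))"
      using m x assms(3) by (intro mult_right_mono) auto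
    \<comment> \<open>The floor leaves at most one extra vertex outside \<open>V\<close>, hence the
      \<open>+ 1\<close>.\<close>
    moreover have "(real n - ?m) * (lam / real n / x) \<le> ((1 - \<delta>) * real n + 1) * (lam / real n / x)"
      using m x assms(3) by (intro mult_right_mono) (auto simp: algebra_simps)
    moreover have "\<delta> * real n * (2 * (lam / real n) / (1 - x)) + ((1 - \<delta>) * real n + 1) * (lam / real n / x)
        = \<rho>0 + lam / x / real n"
      using n x by (simp add: \<rho>0_def field_simps)
    moreover have "lam / x / real n \<le> \<rho> - \<rho>0"
    proof -
      have "lam / x \<le> real n * (\<rho> - \<rho>0)" using nl(2) \<rho>(2) by (subst (asm) pos_divide_le_eq) auto
      then show ?thesis using n by (subst pos_divide_le_eq) (auto simp: mult.commute)
    qed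
    ultimately show "?m * (2 * (lam / real n) / (1 - x)) + (real n - ?m) * (lam / real n / x) \<le> \<rho>"
      by linarith
    show "\<rho> < 1" by (rule \<rho>)
  qed (use H in blast)
  \<comment> \<open>For the finitely many smaller \<open>n\<close> a deterministic bound suffices:
    all edges are subsets of \<open>{1..n}\<close>.\<close>
  have small: "measure_pmf.expectation (planted_cycles_given n lam Hs)
      (\<lambda>G. real (card (sym_diff Hs (H G)))) \<le> 2 ^ N"
    if n: "n < N" and Hs: "Hs \<in> two_factors_in (complete_edges n) (planted_size \<delta> n)"
      and H: "\<forall>G \<in> set_pmf (planted_cycles_given n lam Hs). H G \<in> two_factors_in G (planted_size \<delta> n)"
    for n Hs H
  proof (rule measure_pmf.integral_le_const)
    have Hs': "Hs \<subseteq> complete_edges n" using Hs by (auto simp: two_factors_in_def)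
    have G: "G \<subseteq> complete_edges n" if "G \<in> set_pmf (planted_cycles_given n lam Hs)" for G
      using that Hs' set_pmf_erdos_renyi by (fastforce simp: planted_cycles_given_def)
    then have "set_pmf (planted_cycles_given n lam Hs) \<subseteq> Pow (complete_edges n)" by blast
    then have "finite (set_pmf (planted_cycles_given n lam Hs))"
      by (rule finite_subset) (simp add: finite_complete_edges)
    then show "integrable (measure_pmf (planted_cycles_given n lam Hs)) (\<lambda>G. real (card (sym_diff Hs (H G))))"
      by (rule integrable_measure_pmf_finite)
    have "real (card (sym_diff Hs (H G))) \<le> 2 ^ N" if "G \<in> set_pmf (planted_cycles_given n lam Hs)" for G
    proof -
      have "H G \<subseteq> complete_edges n" using H G[OF that] that by (fastforce simp: two_factors_in_def)
      then have "sym_diff Hs (H G) \<subseteq> Pow {1..n}" using Hs' by (auto simp: complete_edges_def)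
      then have "card (sym_diff Hs (H G)) \<le> card (Pow {1..n})" by (rule card_mono[rotated]) simp
      also have "\<dots> \<le> 2 ^ N" using n by (simp add: card_Pow power_increasing)
      finally show ?thesis by (simp flip: of_nat_le_iff)
    qed
    then show "AE G in measure_pmf (planted_cycles_given n lam Hs). real (card (sym_diff Hs (H G))) \<le> 2 ^ N"
      by (simp add: AE_measure_pmf_iff)
  qed
  show ?thesis
  proof (intro exI[of _ "max (2 / (1 - \<rho>)\<^sup>2) (2 ^ N)"] allI ballI impI)
    fix n :: nat and Hs and H :: "nat graph \<Rightarrow> nat graph"
    assume A: "1 \<le> n" "Hs \<in> two_factors_in (complete_edges n) (planted_size \<delta> n)"
      "\<forall>G \<in> set_pmf (planted_cycles_given n lam Hs). H G \<in> two_factors_in G (planted_size \<delta> n)"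
    show "measure_pmf.expectation (planted_cycles_given n lam Hs)
        (\<lambda>G. real (card (sym_diff Hs (H G)))) \<le> max (2 / (1 - \<rho>)\<^sup>2) (2 ^ N)"
      using large[OF A(1) _ A(2,3)] small[OF _ A(2,3)] by (cases "N \<le> n") (auto simp: le_max_iff_disj)
  qed
qed

end
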